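(* Let $PG_n$ be the random pentagonal chain network described in the context, and assume Hypotheses 1 and 2 of the context hold. Then: (i) For $n\ge 1$, $$Var\big(Kf^{*}(PG_{n})\big)=\frac{1}{30}\Big(\sigma^{2}_{3}n^{5}-5r_{3}n^{4}+10\tilde{\sigma}^{2}_{3}n^{3}+(65r_{3}-30\sigma^{2}_{3}-45\tilde{\sigma}^{2}_{3})n^{2}+(59\sigma^{2}_{3}+65\tilde{\sigma}^{2}_{3}-120r_{3})n+(60r_{3}-30\sigma^{2}_{3}-30\tilde{\sigma}^{2}_{3})\Big),$$ where $\sigma^{2}_{3}=(\tfrac{1296}{5})^{2}p_{1}+(\tfrac{1584}{5})^{2}(1-p_{1})-\big(\tfrac{1296}{5}p_{1}+\tfrac{1584}{5}(1-p_{1})\big)^{2}$, $\tilde{\sigma}^{2}_{3}=(\tfrac{876}{5})^{2}p_{1}+(\tfrac{1164}{5})^{2}(1-p_{1})-\big(\tfrac{876}{5}p_{1}+\tfrac{1164}{5}(1-p_{1})\big)^{2}$, $r_{3}=\tfrac{1296}{5}\cdot\tfrac{876}{5}p_{1}+\tfrac{1584}{5}\cdot\tfrac{1164}{5}(1-p_{1})-\big(\tfrac{1296}{5}p_{1}+\tfrac{1584}{5}(1-p_{1})\big)\big(\tfrac{876}{5}p_{1}+\tfrac{1164}{5}(1-p_{1})\big)$. (ii) $Kf^{*}(PG_n)$ is asymptotically normal: $$\lim_{n\rightarrow \infty}\sup_{a\in \mathbb{R}}\Big| \mathbb{P}\Big(\frac{Kf^{*}(PG_{n})-\mathbb{E}\big(Kf^{*}(PG_{n})\big)}{\sqrt{Var\big(Kf^{*}(PG_{n})\big)}}\leq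 a\Big)-\int^{a}_{-\infty}\frac{1}{\sqrt{2\pi}}e^{-t^{2}/2}\,dt \Big| =0.$$
   Context: Random chain network $PG_n$: $PG_1$ is a $5$-cycle (pentagon). For $n\ge 1$, $PG_{n+1}$ is obtained from $PG_n$ by adding a new pentagon $O_{n+1}$ with vertices $x_1,\dots,x_5$ in cyclic order and adding one edge joining $x_1$ to a vertex $u_n$ of $PG_n$. The vertex $u_1$ is any vertex of $PG_1$. For $n\ge 2$, $u_n$ is a vertex of the last pentagon $O_n$ (whose vertex $x_1$ is the one joined to $u_{n-1}$): either $u_n\in\{x_2,x_5\}$ of $O_n$ (neighbours of $x_1$ in $O_n$; set $Z_n^1=1$, $Z_n^2=0$) or $u_n\in\{x_3,x_4\}$ of $O_n$ (vertices at distance $2$ from $x_1$ in $O_n$; set $Z_n^1=0$, $Z_n^2=1$), with $\mathbb{P}(Z_n^1=1)=p_1$, $\mathbb{P}(Z_n^2=1)=p_2=1-p_1$, constants independent of $n$. Hypothesis 1: the random vectors $(Z_n^1,Z_n^2)$, $n=2,3,\dots$, are independent. Hypothesis 2: $0<p_i<1$ for $i=1,2$. For a graph $G$, $d(v)$ is the degree of $v$, $r(u,v)$ the resistance distance (effective resistance between $u$ and $v$ when every edge is a unit resistor), and the multiplicative degree-Kirchhoff index is $Kf^{*}(G)=\sum_{\{u,v\}\subseteq V_G} d(u)d(v)\,r(u,v)$ over unordered pairs of distinct vertices. *)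

theory Defs
  imports "HOL-Probability.Probability"
begin

definition degree :: "'v set \<Rightarrow> ('v \<Rightarrow> 'v \<Rightarrow> bool) \<Rightarrow> 'v \<Rightarrow> nat" where
  "degree V adj v = card {w \<in> V. adj v w}"

text \<open>Resistance distance (effective resistance, unit resistors): the potential difference
  phi u - phi v for a potential phi satisfying Kirchhoff's current law when a unit current
  enters at u and leaves at v, i.e. L phi = e_u - e_v with L the graph Laplacian.\<close>
definition resistance :: "'v set \<Rightarrow> ('v \<Rightarrow> 'v \<Rightarrow> bool) \<Rightarrow> 'v \<Rightarrow> 'v \<Rightarrow> real" where
  "resistance V adj u v =
     (THE r. \<exists>phi :: 'v \<Rightarrow> real.
        (\<forall>w \<in> V. (\<Sum>x \<in> {x \<in> V. adj w x}. phi w - phi x)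
                   = (if w = u then 1 else 0) - (if w = v then 1 else 0))
        \<and> r = phi u - phi v)"

text \<open>Multiplicative degree-Kirchhoff index: sum over unordered pairs of distinct vertices,
  written as half the sum over ordered pairs of distinct vertices.\<close>
definition kf_star :: "'v set \<Rightarrow> ('v \<Rightarrow> 'v \<Rightarrow> bool) \<Rightarrow> real" where
  "kf_star V adj =
     (\<Sum>u \<in> V. \<Sum>v \<in> V. if u \<noteq> v
        then real (degree V adj u) * real (degree V adj v) * resistance V adj u v else 0) / 2"

text \<open>Vertex (i, j): vertex x_(j+1) of the i-th pentagon O_i, for 1 <= i <= n, 0 <= j <= 4.
  So j = 0 is x_1, j in {1,4} are x_2, x_5, and j in {2,3} are x_3, x_4.
  The choice sequence c gives, for each i, the index j = c i of u_i in O_i; the edge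
  joins (i, c i) to (i+1, 0) (the x_1 of O_(i+1)).\<close>
definition pg_verts :: "nat \<Rightarrow> (nat \<times> nat) set" where
  "pg_verts n = {1..n} \<times> {0..<5}"

definition pg_adj :: "nat \<Rightarrow> (nat \<Rightarrow> nat) \<Rightarrow> nat \<times> nat \<Rightarrow> nat \<times> nat \<Rightarrow> bool" where
  "pg_adj n c a b =
     (a \<in> pg_verts n \<and> b \<in> pg_verts n \<and>
      ((fst a = fst b \<and> (snd b = (snd a + 1) mod 5 \<or> snd a = (snd b + 1) mod 5))
       \<or> (fst b = fst a + 1 \<and> snd a = c (fst a) \<and> snd b = 0)
       \<or> (fst a = fst b + 1 \<and> snd b = c (fst b) \<and> snd a = 0)))"

definition kf_PG :: "nat \<Rightarrow> (nat \<Rightarrow> nat) \<Rightarrow> real" where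
  "kf_PG n c = kf_star (pg_verts n) (pg_adj n c)"

definition sigma3sq :: "real \<Rightarrow> real" where
  "sigma3sq p1 = (1296/5)^2 * p1 + (1584/5)^2 * (1 - p1)
                 - (1296/5 * p1 + 1584/5 * (1 - p1))^2"

definition sigma3sq_tilde :: "real \<Rightarrow> real" where
  "sigma3sq_tilde p1 = (876/5)^2 * p1 + (1164/5)^2 * (1 - p1)
                 - (876/5 * p1 + 1164/5 * (1 - p1))^2"

definition r3 :: "real \<Rightarrow> real" where
  "r3 p1 = 1296/5 * (876/5) * p1 + 1584/5 * (1164/5) * (1 - p1)
           - (1296/5 * p1 + 1584/5 * (1 - p1)) * (876/5 * p1 + 1164/5 * (1 - p1))"

end

theory Submission
  imports Defs "HOL-Real_Asymp.Real_Asymp"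
begin

text \<open>
  The chain is tree-like, so its resistance distance adds up along bridges and pentagons; that the
  explicit function \<open>R\<close> obtained this way is the resistance follows from
  \<open>L R(\<cdot>, u) = \<tau> - 2 \<delta>\<^sub>u\<close> with \<open>\<tau>\<close> independent of \<open>u\<close>. Summing against the degrees, the index
  becomes a constant plus \<open>144 (k - 1) (n - k) r\<^sub>k\<close> summed over \<open>k\<close>, where \<open>r\<^sub>k\<close> is \<open>4/5\<close> or \<open>6/5\<close>
  according to the choice made in pentagon \<open>k\<close>. It is therefore a weighted sum of independent two-point
  variables. Its variance is \<open>(288/5)\<^sup>2 p\<^sub>1 (1 - p\<^sub>1) ((n - 1)\<^sup>5 - (n - 1)) / 30\<close>, and
  \<open>\<sigma>\<^sub>3\<^sup>2\<close>, its tilde version and \<open>r\<^sub>3\<close> all equal \<open>(288/5)\<^sup>2 p\<^sub>1 (1 - p\<^sub>1)\<close>. The weights are of order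
  \<open>n\<^sup>2\<close>, negligible against the standard deviation of order \<open>n\<^bsup>5/2\<^esup>\<close>, so Lyapunov's argument with
  characteristic functions yields the normal limit, and Polya's theorem makes it uniform.
\<close>

section \<open>Resistance distance in the pentagonal chain\<close>

text \<open>Written as double sums over \<open>V\<close>, the diagonal parts agree pointwise, and
  the mixed parts agree after exchanging the sums, because adjacency is symmetric.\<close>

lemma laplacian_self_adjoint:
  fixes phi psi :: "'v \<Rightarrow> real"
  assumes "finite V" and sym: "\<And>x y. adj x y \<longleftrightarrow> adj y x"
  shows "(\<Sum>w\<in>V. phi w * (\<Sum>x\<in>{x \<in> V. adj w x}. psi w - psi x))
       = (\<Sum>w\<in>V. psi w * (\<Sum>x\<in>{x \<in> V. adj w x}. phi w - phi x))"
proof -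
  have expand: "(\<Sum>w\<in>V. f w * (\<Sum>x\<in>{x \<in> V. adj w x}. g w - g x))
      = (\<Sum>w\<in>V. \<Sum>x\<in>V. if adj w x then f w * g w else 0)
        - (\<Sum>w\<in>V. \<Sum>x\<in>V. if adj w x then f w * g x else 0)" for f g :: "'v \<Rightarrow> real"
    unfolding sum_subtractf[symmetric] sum_distrib_left sum.inter_filter[OF \<open>finite V\<close>]
    by (intro sum.cong refl) (auto simp: algebra_simps)
  have "(\<Sum>w\<in>V. \<Sum>x\<in>V. if adj w x then phi w * psi x else 0)
      = (\<Sum>w\<in>V. \<Sum>x\<in>V. if adj w x then psi w * phi x else 0)"
    by (subst sum.swap) (auto intro!: sum.cong simp: sym)
  then show ?thesis
    unfolding expand by (simp add: mult.commute cong: if_cong)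
qed

text \<open>Self-adjointness of the Laplacian gives uniqueness of the potential difference, without
  any connectivity assumption.\<close>
lemma resistance_eq_potential_difference:
  assumes V: "finite V" and sym: "\<And>x y. adj x y \<longleftrightarrow> adj y x" and uv: "u \<in> V" "v \<in> V"
    and phi: "\<forall>w\<in>V. (\<Sum>x\<in>{x \<in> V. adj w x}. phi w - phi x)
                = (if w = u then 1 else 0) - (if w = v then 1 else (0::real))"
  shows "resistance V adj u v = phi u - phi v"
  unfolding resistance_def
proof (rule the_equality)
  show "\<exists>phi'. (\<forall>w\<in>V. (\<Sum>x\<in>{x \<in> V. adj w x}. phi' w - phi' x)
                = (if w = u then 1 else 0) - (if w = v then 1 else 0)) \<and> phi u - phi v = phi' u - phi' v"
    using phi by blast
next
  fix r :: real
  assume "\<exists>phi'. (\<forall>w\<in>V. (\<Sum>x\<in>{x \<in> V. adj w x}. phi' w - phi' x)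
                = (if w = u then 1 else 0) - (if w = v then 1 else (0::real))) \<and> r = phi' u - phi' v"
  then obtain psi where psi: "\<forall>w\<in>V. (\<Sum>x\<in>{x \<in> V. adj w x}. psi w - psi x)
                = (if w = u then 1 else 0) - (if w = v then 1 else 0)"
    and r: "r = psi u - psi v" by blast
  \<comment> \<open>Testing a unit-current potential against any \<open>f\<close> yields
    \<open>f u - f v\<close>. Pairing two such potentials with each other, in both orders, forces
    their potential differences to coincide.\<close>
  have pairing: "(\<Sum>w\<in>V. f w * (\<Sum>x\<in>{x \<in> V. adj w x}. g w - g x)) = f u - f v"
    if "\<forall>w\<in>V. (\<Sum>x\<in>{x \<in> V. adj w x}. g w - g x)
                = (if w = u then 1 else 0) - (if w = v then 1 else (0::real))"
    for f g :: "'a \<Rightarrow> real"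
  proof -
    have "(\<Sum>w\<in>V. f w * (\<Sum>x\<in>{x \<in> V. adj w x}. g w - g x))
        = (\<Sum>w\<in>V. (if w = u then f w else 0) - (if w = v then f w else 0))"
      using that by (intro sum.cong refl) auto
    then show ?thesis
      using V uv by (simp add: sum_subtractf)
  qed
  show "r = phi u - phi v"
    using laplacian_self_adjoint[OF V sym, of phi psi] pairing[OF phi, of psi] pairing[OF psi, of phi] r
    by simp
qed

text \<open>Subtracting the columns of \<open>R\<close> at \<open>u\<close> and \<open>v\<close>
  cancels \<open>t\<close> and leaves twice a unit source at \<open>u\<close> and sink at
  \<open>v\<close>. Half the difference is thus a unit-current potential, and its drop from
  \<open>u\<close> to \<open>v\<close> is \<open>(R u v + R v u) / 2\<close>.\<close>

lemma resistance_eqI: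
  assumes V: "finite V" and sym: "\<And>x y. adj x y \<longleftrightarrow> adj y x" and uv: "u \<in> V" "v \<in> V"
    and R_sym: "R u v = R v u" and R_refl: "R u u = 0" "R v v = 0"
    and L: "\<And>w y. w \<in> V \<Longrightarrow> y \<in> V \<Longrightarrow>
      (\<Sum>x\<in>{x \<in> V. adj w x}. R w y - R x y) = t w - (if w = y then 2 else (0::real))"
  shows "resistance V adj u v = R u v"
proof -
  define phi where "phi w = (R w v - R w u) / 2" for w
  have "resistance V adj u v = phi u - phi v"
  proof (rule resistance_eq_potential_difference[OF V sym uv], intro ballI)
    fix w assume w: "w \<in> V"
    have "(\<Sum>x\<in>{x \<in> V. adj w x}. phi w - phi x)
        = ((\<Sum>x\<in>{x \<in> V. adj w x}. R w v - R x v) - (\<Sum>x\<in>{x \<in> V. adj w x}. R w u - R x u)) / 2"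
      unfolding sum_subtractf[symmetric] sum_divide_distrib
      by (intro sum.cong refl) (simp add: phi_def field_simps)
    then show "(\<Sum>x\<in>{x \<in> V. adj w x}. phi w - phi x)
        = (if w = u then 1 else 0) - (if w = v then 1 else 0)"
      unfolding L[OF w uv(1)] L[OF w uv(2)] by (auto split: if_splits)
  qed
  then show ?thesis
    using R_sym R_refl by (simp add: phi_def)
qed

section \<open>Explicit resistances in a pentagon and along the chain\<close>

text \<open>Two parallel paths of lengths \<open>d\<close> and \<open>5 - d\<close> have resistance
  \<open>d * (5 - d) / 5\<close>. The expression is invariant under exchanging the two lengths, so
  for indices below 5 their plain difference can replace the cyclic distance.\<close>

definition pentagon_res :: "nat \<Rightarrow> nat \<Rightarrow> real" where
  "pentagon_res a b = \<bar>real a - real b\<bar> * (5 - \<bar>real a - real b\<bar>) / 5"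

text \<open>For \<open>i < j\<close>, the resistance between the exit \<open>(i, c i)\<close> of pentagon \<open>i\<close> and the entry \<open>(j, 0)\<close> of
  pentagon \<open>j\<close>.\<close>
definition gate_res :: "(nat \<Rightarrow> nat) \<Rightarrow> nat \<Rightarrow> nat \<Rightarrow> real" where
  "gate_res c i j = (\<Sum>k\<in>{i..<j}. 1 + pentagon_res 0 (c k)) - pentagon_res 0 (c i)"

text \<open>Series law, always read from the pentagon of lower index to the one of higher index,
  which makes the function symmetric.\<close>

definition chain_res :: "(nat \<Rightarrow> nat) \<Rightarrow> nat \<times> nat \<Rightarrow> nat \<times> nat \<Rightarrow> real" where
  "chain_res c u v =
     (let fwd = (\<lambda>x y. pentagon_res (snd x) (c (fst x)) + gate_res c (fst x) (fst y)
                        + pentagon_res 0 (snd y))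
      in if fst u < fst v then fwd u v else if fst v < fst u then fwd v u
         else pentagon_res (snd u) (snd v))"

lemma lt_5_cases: "(a::nat) < 5 \<Longrightarrow> a = 0 \<or> a = 1 \<or> a = 2 \<or> a = 3 \<or> a = 4"
  by linarith

lemma pentagon_res_sym: "pentagon_res a b = pentagon_res b a"
  by (simp add: pentagon_res_def abs_minus_commute)

lemma pentagon_res_refl [simp]: "pentagon_res a a = 0"
  by (simp add: pentagon_res_def)

text \<open>Away from \<open>b\<close> this is the constant second difference of
  \<open>d * (5 - d) / 5\<close>; at \<open>b\<close> both neighbours have resistance 4/5, giving
  -8/5. The predecessor is written \<open>a + 4\<close> to avoid subtraction on naturals.\<close>

lemma pentagon_laplacian:
  assumes "a < 5" "b < 5"
  shows "(pentagon_res a b - pentagon_res ((a + 1) mod 5) b)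
       + (pentagon_res a b - pentagon_res ((a + 4) mod 5) b) = 2/5 - (if a = b then 2 else 0)"
  using lt_5_cases[OF assms(1)] lt_5_cases[OF assms(2)]
  by (elim disjE) (simp_all add: pentagon_res_def)

lemma sum_lt_5: "(\<Sum>a\<in>{0..<5::nat}. f a) = f 0 + f 1 + f 2 + f 3 + (f 4 :: real)"
  by (simp add: eval_nat_numeral)

lemma sum_pentagon_res:
  assumes "b < 5"
  shows "(\<Sum>a\<in>{0..<5}. pentagon_res a b) = 4"
  using lt_5_cases[OF assms] by (elim disjE) (simp_all add: sum_lt_5 pentagon_res_def)

lemma gate_res_Suc: "gate_res c i (Suc i) = 1"
  by (simp add: gate_res_def)

lemma gate_res_step_right:
  "i < j \<Longrightarrow> gate_res c i (Suc j) = gate_res c i j + 1 + pentagon_res 0 (c j)"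
  by (simp add: gate_res_def)

lemma gate_res_step_left:
  "Suc i < j \<Longrightarrow> gate_res c i j = gate_res c (Suc i) j + 1 + pentagon_res 0 (c (Suc i))"
  by (simp add: gate_res_def sum.atLeast_Suc_lessThan[of i j])

text \<open>The term subtracted in \<open>gate_res\<close> cancels the crossing of pentagon
  \<open>i\<close>, leaving \<open>j - i\<close> bridges and the crossings of the pentagons strictly
  between.\<close>

lemma gate_res_eq:
  "i < j \<Longrightarrow> gate_res c i j = real (j - i) + (\<Sum>k\<in>{i<..<j}. pentagon_res 0 (c k))"
  by (simp add: gate_res_def sum.distrib sum.atLeast_Suc_lessThan[of i j] atLeastSucLessThan_greaterThanLessThan)

lemma finite_pg_verts [simp]: "finite (pg_verts n)"
  by (simp add: pg_verts_def)

lemma pg_adj_sym: "pg_adj n c x y \<longleftrightarrow> pg_adj n c y x"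
  by (auto simp: pg_adj_def)

lemma cycle_5_neighbour_iff:
  assumes "a < 5" "b < 5"
  shows "(b = (a + 1) mod 5 \<or> a = (b + 1) mod 5) \<longleftrightarrow> (b = (a + 1) mod 5 \<or> b = (a + 4) mod (5::nat))"
  using lt_5_cases[OF assms(1)] lt_5_cases[OF assms(2)] by (elim disjE) simp_all

text \<open>Used for the Laplacian of \<open>chain_res\<close> and, with \<open>f\<close> constantly
  1, for the degrees.\<close>

lemma sum_pg_neighbours:
  fixes f :: "nat \<times> nat \<Rightarrow> real"
  assumes c: "\<And>i. i \<in> {1..n} \<Longrightarrow> c i < 5" and i: "i \<in> {1..n}" and a: "a < 5"
  shows "(\<Sum>x\<in>{x \<in> pg_verts n. pg_adj n c (i, a) x}. f x)
       = f (i, (a + 1) mod 5) + f (i, (a + 4) mod 5)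
         + (if a = c i \<and> i < n then f (i + 1, 0) else 0)
         + (if a = 0 \<and> 1 < i then f (i - 1, c (i - 1)) else 0)"
proof -
  let ?P = "{(i, (a + 1) mod 5), (i, (a + 4) mod 5)}"
  let ?Q = "if a = c i \<and> i < n then {(i + 1, 0)} else {}"
  let ?S = "if a = 0 \<and> 1 < i then {(i - 1, c (i - 1))} else {}"
  have "x \<in> {x \<in> pg_verts n. pg_adj n c (i, a) x} \<longleftrightarrow> x \<in> (?P \<union> ?Q) \<union> ?S" for x
  proof (cases x)
    case (Pair j b)
    consider "j = i" | "j = i + 1" | "i = j + 1" | "j \<noteq> i" "j \<noteq> i + 1" "i \<noteq> j + 1" by blast
    then show ?thesis
    proof cases
      case 1
      then show ?thesis
        using cycle_5_neighbour_iff[OF a, of b] a i by (auto simp: Pair pg_adj_def pg_verts_def)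
    next
      case 2
      then show ?thesis using a i by (auto simp: Pair pg_adj_def pg_verts_def)
    next
      case 3
      then show ?thesis using a i c[of j] by (auto simp: Pair pg_adj_def pg_verts_def)
    next
      case 4
      then show ?thesis by (auto simp: Pair pg_adj_def)
    qed
  qed
  then have "{x \<in> pg_verts n. pg_adj n c (i, a) x} = (?P \<union> ?Q) \<union> ?S"
    by blast
  moreover have "(a + 1) mod 5 \<noteq> (a + 4) mod 5"
    using lt_5_cases[OF a] by (elim disjE) simp_all
  moreover have "sum f ((?P \<union> ?Q) \<union> ?S) = sum f (?P \<union> ?Q) + sum f ?S"
    by (rule sum.union_disjoint) auto
  moreover have "sum f (?P \<union> ?Q) = sum f ?P + sum f ?Q"
    by (rule sum.union_disjoint) auto
  ultimately show ?thesis
    by simp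
qed

lemma degree_pg:
  assumes "\<And>i. i \<in> {1..n} \<Longrightarrow> c i < 5" "i \<in> {1..n}" "a < 5"
  shows "real (degree (pg_verts n) (pg_adj n c) (i, a))
       = 2 + (if a = c i \<and> i < n then 1 else 0) + (if a = 0 \<and> 1 < i then 1 else 0)"
  using sum_pg_neighbours[OF assms, where f = "\<lambda>_. 1"] by (simp add: degree_def)

lemma chain_res_less:
  "i < j \<Longrightarrow> chain_res c (i, a) (j, b) = pentagon_res a (c i) + gate_res c i j + pentagon_res 0 b"
  by (simp add: chain_res_def)

lemma chain_res_greater:
  "j < i \<Longrightarrow> chain_res c (i, a) (j, b) = pentagon_res b (c j) + gate_res c j i + pentagon_res 0 a"
  by (simp add: chain_res_def)

lemma chain_res_same: "chain_res c (i, a) (i, b) = pentagon_res a b"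
  by (simp add: chain_res_def)

text \<open>The cycle contributes 2/5, and -2 at the gate facing \<open>u\<close> (at
  \<open>u\<close> itself in its own pentagon). A bridge leading away from \<open>u\<close>
  contributes -1, one leading towards \<open>u\<close> contributes +1. At the gate facing
  \<open>u\<close> the total -2 + 1 is again -1, so the bracket is independent of \<open>u\<close>,
  as \<open>resistance_eqI\<close> demands.\<close>

lemma chain_res_laplacian:
  assumes c: "\<And>i. i \<in> {1..n} \<Longrightarrow> c i < 5" and w: "w \<in> pg_verts n" and u: "u \<in> pg_verts n"
  shows "(\<Sum>x\<in>{x \<in> pg_verts n. pg_adj n c w x}. chain_res c w u - chain_res c x u)
       = (2/5 - (if snd w = c (fst w) \<and> fst w < n then 1 else 0) - (if snd w = 0 \<and> 1 < fst w then 1 else 0))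
         - (if w = u then 2 else 0)"
proof -
  obtain i a where wia: "w = (i, a)" and i: "i \<in> {1..n}" and a: "a < 5"
    using w by (auto simp: pg_verts_def)
  obtain j b where ujb: "u = (j, b)" and j: "j \<in> {1..n}" and b: "b < 5"
    using u by (auto simp: pg_verts_def)
  let ?R = "\<lambda>x. chain_res c x u"
  have sum_eq: "(\<Sum>x\<in>{x \<in> pg_verts n. pg_adj n c w x}. ?R w - ?R x)
      = ((?R (i, a) - ?R (i, (a + 1) mod 5)) + (?R (i, a) - ?R (i, (a + 4) mod 5)))
        + (if a = c i \<and> i < n then ?R (i, c i) - ?R (i + 1, 0) else 0)
        + (if a = 0 \<and> 1 < i then ?R (i, 0) - ?R (i - 1, c (i - 1)) else 0)"
    unfolding wia by (subst sum_pg_neighbours[OF c i a]) auto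
  consider "i < j" | "i = j" | "j < i" by linarith
  then show ?thesis
  proof cases
    case 1
    have pent: "(?R (i, a) - ?R (i, (a + 1) mod 5)) + (?R (i, a) - ?R (i, (a + 4) mod 5))
        = 2/5 - (if a = c i then 2 else 0)"
      using pentagon_laplacian[OF a c[OF i]] 1 by (simp add: ujb chain_res_less)
    have right: "?R (i, c i) - ?R (i + 1, 0) = 1"
      using 1 gate_res_step_left[of i j c]
      by (cases "j = Suc i") (simp_all add: ujb chain_res_less chain_res_same gate_res_Suc)
    have left: "?R (i, 0) - ?R (i - 1, c (i - 1)) = -1" if "1 < i"
      using 1 that gate_res_step_left[of "i - 1" j c] by (cases i) (simp_all add: ujb chain_res_less)
    show ?thesis
      using 1 j left unfolding sum_eq pent right by (auto simp: wia ujb)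
  next
    case 2
    have pent: "(?R (i, a) - ?R (i, (a + 1) mod 5)) + (?R (i, a) - ?R (i, (a + 4) mod 5))
        = 2/5 - (if a = b then 2 else 0)"
      using pentagon_laplacian[OF a b] 2 by (simp add: ujb chain_res_same)
    have right: "?R (i, c i) - ?R (i + 1, 0) = -1"
      using 2 by (simp add: ujb chain_res_greater chain_res_same gate_res_Suc pentagon_res_sym[of b])
    have left: "?R (i, 0) - ?R (i - 1, c (i - 1)) = -1" if "1 < i"
      using 2 that gate_res_Suc[of c "i - 1"]
      by (cases i) (simp_all add: ujb chain_res_less chain_res_same)
    show ?thesis
      using 2 left unfolding sum_eq pent right by (auto simp: wia ujb)
  next
    case 3
    have pent: "(?R (i, a) - ?R (i, (a + 1) mod 5)) + (?R (i, a) - ?R (i, (a + 4) mod 5))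
        = 2/5 - (if a = 0 then 2 else 0)"
      using pentagon_laplacian[OF a, of 0] 3 by (simp add: ujb chain_res_greater pentagon_res_sym[of 0])
    have right: "?R (i, c i) - ?R (i + 1, 0) = -1"
      using 3 gate_res_step_right[of j i c] by (simp add: ujb chain_res_greater)
    \<comment> \<open>The left bridge ends in pentagon \<open>m\<close>. If \<open>j = m\<close>,
      that end shares the pentagon of \<open>u\<close>, so the step rule for
      \<open>gate_res\<close>, which needs \<open>j < m\<close>, is replaced by
      \<open>gate_res_Suc\<close>.\<close>
    obtain m where m: "i = Suc m" "j \<le> m"
      using 3 by (cases i) auto
    have left: "?R (i, 0) - ?R (i - 1, c (i - 1)) = 1"
      using gate_res_step_right[of j m c] m
      by (cases "j = m")
        (simp_all add: ujb chain_res_greater chain_res_same gate_res_Suc pentagon_res_sym[of b])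
    show ?thesis
      using 3 j unfolding sum_eq pent right left by (auto simp: wia ujb)
  qed
qed

lemma chain_res_sym: "chain_res c u v = chain_res c v u"
  by (simp add: chain_res_def pentagon_res_sym[of "snd u" "snd v"])

lemma chain_res_refl [simp]: "chain_res c u u = 0"
  by (simp add: chain_res_def)

lemma resistance_pg:
  assumes "\<And>i. i \<in> {1..n} \<Longrightarrow> c i < 5" and "u \<in> pg_verts n" "v \<in> pg_verts n"
  shows "resistance (pg_verts n) (pg_adj n c) u v = chain_res c u v"
  by (rule resistance_eqI[where R = "chain_res c", OF finite_pg_verts pg_adj_sym assms(2,3)
        chain_res_sym chain_res_refl chain_res_refl chain_res_laplacian[OF assms(1)]])

section \<open>The degree-Kirchhoff index of the chain\<close>

lemma sum_symmetric_pairs: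
  fixes T :: "'i::linorder \<Rightarrow> 'i \<Rightarrow> real"
  assumes "finite I" and sym: "\<And>i j. i \<in> I \<Longrightarrow> j \<in> I \<Longrightarrow> T i j = T j i"
  shows "(\<Sum>i\<in>I. \<Sum>j\<in>I. T i j) = (\<Sum>i\<in>I. T i i) + 2 * (\<Sum>i\<in>I. \<Sum>j\<in>I. if i < j then T i j else 0)"
proof -
  have "(\<Sum>i\<in>I. \<Sum>j\<in>I. T i j) = (\<Sum>i\<in>I. \<Sum>j\<in>I. (if i = j then T i j else 0)
      + (if i < j then T i j else 0) + (if j < i then T j i else 0))"
    by (intro sum.cong refl) (auto simp: sym)
  also have "\<dots> = (\<Sum>i\<in>I. T i i) + (\<Sum>i\<in>I. \<Sum>j\<in>I. if i < j then T i j else 0)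
      + (\<Sum>i\<in>I. \<Sum>j\<in>I. if j < i then T j i else 0)"
    using \<open>finite I\<close> by (simp add: sum.distrib)
  also have "(\<Sum>i\<in>I. \<Sum>j\<in>I. if j < i then T j i else 0) = (\<Sum>i\<in>I. \<Sum>j\<in>I. if i < j then T i j else 0)"
    by (rule sum.swap)
  finally show ?thesis by simp
qed

text \<open>Pentagon \<open>k\<close> is crossed by exactly the pairs it separates, so after
  exchanging the sums its coefficient factors into the mass on its left times the mass on its
  right.\<close>

lemma sum_between:
  fixes s r :: "'i::linorder \<Rightarrow> real"
  shows "(\<Sum>i\<in>I. \<Sum>j\<in>I. s i * s j * (\<Sum>k\<in>I. if i < k \<and> k < j then r k else 0))
       = (\<Sum>k\<in>I. r k * (\<Sum>i\<in>I. if i < k then s i else 0) * (\<Sum>j\<in>I. if k < j then s j else 0))"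
proof -
  have "(\<Sum>i\<in>I. \<Sum>j\<in>I. s i * s j * (\<Sum>k\<in>I. if i < k \<and> k < j then r k else 0))
      = (\<Sum>i\<in>I. \<Sum>j\<in>I. \<Sum>k\<in>I. r k * ((if i < k then s i else 0) * (if k < j then s j else 0)))"
    unfolding sum_distrib_left by (intro sum.cong refl) auto
  also have "\<dots> = (\<Sum>i\<in>I. \<Sum>k\<in>I. \<Sum>j\<in>I. r k * ((if i < k then s i else 0) * (if k < j then s j else 0)))"
    by (intro sum.cong refl sum.swap)
  also have "\<dots> = (\<Sum>k\<in>I. \<Sum>i\<in>I. \<Sum>j\<in>I. r k * ((if i < k then s i else 0) * (if k < j then s j else 0)))"
    by (rule sum.swap)
  also have "\<dots> = (\<Sum>k\<in>I. r k * (\<Sum>i\<in>I. if i < k then s i else 0) * (\<Sum>j\<in>I. if k < j then s j else 0))"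
    by (simp add: sum_distrib_left[symmetric] sum_distrib_right[symmetric] mult.assoc)
  finally show ?thesis .
qed

text \<open>The part of the index that does not depend on the choices: \<open>s i\<close> is the
  degree sum of pentagon \<open>i\<close>, the first sum collects pairs inside one pentagon, the
  second collects bridges and mean distances to the gates. It stays a raw sum because it cancels on
  centring.\<close>

definition kf_PG_offset :: "nat \<Rightarrow> real" where
  "kf_PG_offset n =
     (let e = (\<lambda>i. of_bool (1 < i)); f = (\<lambda>i. of_bool (i < n)); s = (\<lambda>i. 10 + e i + f i)
      in (\<Sum>i\<in>{1..n}. 40 + 8 * (e i + f i))
         + (\<Sum>i\<in>{1..n}. \<Sum>j\<in>{1..n}. if i < j then 8 * s j + 8 * s i + s i * s j * real (j - i) else 0))"

text \<open>Pentagon \<open>k\<close> contributes \<open>pentagon_res 0 (c k)\<close> once for each pair of edge ends, one on its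
  left and one on its right, where the bridge ends at its gates \<open>(k, 0)\<close> and \<open>(k, c k)\<close> count as left
  and right respectively; there are \<open>12 * (k - 1)\<close> and \<open>12 * (n - k)\<close> of these.\<close>
lemma kf_PG_eq:
  assumes c: "\<And>i. i \<in> {1..n} \<Longrightarrow> c i < 5"
  shows "kf_PG n c = kf_PG_offset n
       + (\<Sum>k\<in>{1..n}. 144 * (real k - 1) * (real n - real k) * pentagon_res 0 (c k))"
proof -
  let ?I = "{1..n}" and ?J = "{0..<5::nat}"
  define e :: "nat \<Rightarrow> real" where "e i = of_bool (1 < i)" for i
  define f :: "nat \<Rightarrow> real" where "f i = of_bool (i < n)" for i
  define s where "s i = 10 + e i + f i" for i
  define r where "r k = pentagon_res 0 (c k)" for k
  define d where "d i a = 2 + f i * of_bool (a = c i) + e i * of_bool (a = 0)" for i a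
  define T where "T i j = (\<Sum>a\<in>?J. \<Sum>b\<in>?J. d i a * d j b * chain_res c (i, a) (j, b))" for i j
  \<comment> \<open>A degree is 2 plus the number of bridge ends, so every degree-weighted sum
    reduces to a uniform sum and the values at the two gates.\<close>
  have weighted: "(\<Sum>a\<in>?J. d i a * g a) = 2 * (\<Sum>a\<in>?J. g a) + f i * g (c i) + e i * g 0"
    if "i \<in> ?I" for i and g :: "nat \<Rightarrow> real"
  proof -
    have "(\<Sum>a\<in>?J. d i a * g a)
        = (\<Sum>a\<in>?J. 2 * g a + f i * (if a = c i then g a else 0) + e i * (if a = 0 then g a else 0))"
      by (intro sum.cong refl) (auto simp: d_def algebra_simps)
    then show ?thesis
      using c[OF that] by (simp add: sum.distrib sum_distrib_left[symmetric])
  qed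
  have d_sum: "(\<Sum>a\<in>?J. d i a) = s i" if "i \<in> ?I" for i
    using weighted[OF that, of "\<lambda>_. 1"] by (simp add: s_def)
  \<comment> \<open>Each 8 is twice the uniform sum 4 of \<open>sum_pentagon_res\<close>. Of the two
    gates only the far one adds to it, namely \<open>r i\<close> or \<open>r j\<close>, as the near
    gate is at distance 0.\<close>
  have T_less: "T i j = s j * (8 + e i * r i) + s i * (8 + f j * r j) + s i * s j * gate_res c i j"
    if ij: "i \<in> ?I" "j \<in> ?I" "i < j" for i j
  proof -
    have "T i j = (\<Sum>a\<in>?J. \<Sum>b\<in>?J. (d i a * pentagon_res a (c i)) * d j b
        + d i a * (d j b * pentagon_res 0 b) + (d i a * d j b) * gate_res c i j)"
      unfolding T_def using ij(3) by (intro sum.cong refl) (simp add: chain_res_less algebra_simps)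
    also have "\<dots> = (\<Sum>a\<in>?J. d i a * pentagon_res a (c i)) * (\<Sum>b\<in>?J. d j b)
        + (\<Sum>a\<in>?J. d i a) * (\<Sum>b\<in>?J. d j b * pentagon_res 0 b)
        + (\<Sum>a\<in>?J. d i a) * (\<Sum>b\<in>?J. d j b) * gate_res c i j"
      unfolding sum.distrib sum_product unfolding sum_distrib_right ..
    also have "(\<Sum>a\<in>?J. d i a * pentagon_res a (c i)) = 8 + e i * r i"
      using weighted[OF ij(1), of "\<lambda>a. pentagon_res a (c i)"] sum_pentagon_res[OF c[OF ij(1)]]
      by (simp add: r_def)
    also have "(\<Sum>b\<in>?J. d j b * pentagon_res 0 b) = 8 + f j * r j"
      using weighted[OF ij(2), of "pentagon_res 0"] sum_pentagon_res[of 0]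
      by (simp add: r_def pentagon_res_sym[of 0])
    finally show ?thesis
      unfolding d_sum[OF ij(1)] d_sum[OF ij(2)] by (simp add: algebra_simps)
  qed
  have T_same: "T i i = 2 * (40 + 8 * (e i + f i) + e i * f i * r i)" if i: "i \<in> ?I" for i
  proof -
    have "T i i = (\<Sum>a\<in>?J. d i a * (\<Sum>b\<in>?J. d i b * pentagon_res b a))"
      unfolding T_def by (intro sum.cong refl)
        (simp add: chain_res_same sum_distrib_left mult.assoc pentagon_res_sym)
    also have "\<dots> = (\<Sum>a\<in>?J. d i a * (8 + f i * pentagon_res (c i) a + e i * pentagon_res 0 a))"
      by (intro sum.cong refl) (simp add: weighted[OF i] sum_pentagon_res)
    also have "\<dots> = 2 * (40 + f i * 4 + e i * 4) + f i * (8 + e i * r i) + e i * (8 + f i * r i)"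
      using sum_pentagon_res[OF c[OF i]] sum_pentagon_res[of 0]
      unfolding weighted[OF i]
      by (simp add: sum.distrib sum_distrib_left[symmetric] r_def pentagon_res_sym[of _ 0]
          pentagon_res_sym[of "c i"])
    finally show ?thesis
      by (simp add: algebra_simps)
  qed
  \<comment> \<open>Pentagon 1 has no left bridge, so the degree sum to the left of
    \<open>k > 1\<close> is one short of \<open>12 * (k - 1)\<close>; the left bridge end of
    \<open>k\<close> itself, counted by \<open>e k\<close>, makes up for it.\<close>
  have left: "e k + (\<Sum>i\<in>?I. if i < k then s i else 0) = 12 * (real k - 1)" if k: "k \<in> ?I" for k
  proof -
    have "(\<Sum>i\<in>?I. if i < k then s i else 0) = (\<Sum>i\<in>{1..<k}. s i)"
      using k by (intro sum.mono_neutral_cong_right) auto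
    also have "\<dots> = (\<Sum>i\<in>{1..<k}. 12 - (if i = 1 then 1 else 0))"
      using k by (intro sum.cong refl) (auto simp: s_def e_def f_def)
    finally show ?thesis
      using k by (auto simp: sum_subtractf e_def algebra_simps of_nat_diff)
  qed
  have right: "f k + (\<Sum>j\<in>?I. if k < j then s j else 0) = 12 * (real n - real k)" if k: "k \<in> ?I" for k
  proof -
    have "(\<Sum>j\<in>?I. if k < j then s j else 0) = (\<Sum>j\<in>{k<..n}. s j)"
      using k by (intro sum.mono_neutral_cong_right) auto
    also have "\<dots> = (\<Sum>j\<in>{k<..n}. 12 - (if j = n then 1 else 0))"
      using k by (intro sum.cong refl) (auto simp: s_def e_def f_def)
    finally show ?thesis
      using k by (auto simp: sum_subtractf f_def algebra_simps of_nat_diff)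
  qed
  have "kf_PG n c = (\<Sum>i\<in>?I. \<Sum>j\<in>?I. T i j) / 2"
  proof -
    have prod: "(\<Sum>u\<in>?I \<times> ?J. g u) = (\<Sum>i\<in>?I. \<Sum>a\<in>?J. g (i, a))" for g :: "nat \<times> nat \<Rightarrow> real"
      by (simp add: sum.cartesian_product)
    \<comment> \<open>The pairs \<open>u = v\<close> left out by \<open>kf_star\<close> may be
      included, since \<open>chain_res\<close> vanishes there.\<close>
    have "2 * kf_PG n c = (\<Sum>u\<in>?I \<times> ?J. \<Sum>v\<in>?I \<times> ?J. d (fst u) (snd u) * d (fst v) (snd v) * chain_res c u v)"
      unfolding kf_PG_def kf_star_def pg_verts_def[symmetric]
      using degree_pg[OF c] resistance_pg[OF c]
      by (auto intro!: sum.cong simp: d_def e_def f_def pg_verts_def)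
    also have "\<dots> = (\<Sum>i\<in>?I. \<Sum>a\<in>?J. \<Sum>j\<in>?I. \<Sum>b\<in>?J. d i a * d j b * chain_res c (i, a) (j, b))"
      by (simp only: prod fst_conv snd_conv)
    also have "\<dots> = (\<Sum>i\<in>?I. \<Sum>j\<in>?I. T i j)"
      unfolding T_def by (intro sum.cong refl sum.swap)
    finally show ?thesis by simp
  qed
  also have "\<dots> = (\<Sum>i\<in>?I. T i i) / 2 + (\<Sum>i\<in>?I. \<Sum>j\<in>?I. if i < j then T i j else 0)"
  proof -
    have "T i j = T j i" for i j
      unfolding T_def by (subst sum.swap) (simp add: chain_res_sym[of c "(i, _)"] mult.commute)
    then show ?thesis
      by (subst sum_symmetric_pairs) simp_all
  qed
  also have "(\<Sum>i\<in>?I. T i i) / 2 = (\<Sum>i\<in>?I. 40 + 8 * (e i + f i)) + (\<Sum>k\<in>?I. r k * (e k * f k))"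
    unfolding sum_divide_distrib sum.distrib[symmetric]
    by (intro sum.cong refl) (simp add: T_same)
  also have "(\<Sum>i\<in>?I. \<Sum>j\<in>?I. if i < j then T i j else 0)
      = (\<Sum>i\<in>?I. \<Sum>j\<in>?I. if i < j then 8 * s j + 8 * s i + s i * s j * real (j - i) else 0)
        + (\<Sum>i\<in>?I. \<Sum>j\<in>?I. e i * r i * (if i < j then s j else 0))
        + (\<Sum>i\<in>?I. \<Sum>j\<in>?I. f j * r j * (if i < j then s i else 0))
        + (\<Sum>i\<in>?I. \<Sum>j\<in>?I. s i * s j * (\<Sum>k\<in>?I. if i < k \<and> k < j then r k else 0))"
    unfolding sum.distrib[symmetric]
  proof (intro sum.cong refl)
    fix i j assume ij: "i \<in> ?I" "j \<in> ?I"
    have "(\<Sum>k\<in>?I. if i < k \<and> k < j then r k else 0) = (\<Sum>k\<in>{i<..<j}. r k)"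
      using ij by (intro sum.mono_neutral_cong_right) auto
    then show "(if i < j then T i j else 0) =
        (if i < j then 8 * s j + 8 * s i + s i * s j * real (j - i) else 0)
        + e i * r i * (if i < j then s j else 0) + f j * r j * (if i < j then s i else 0)
        + s i * s j * (\<Sum>k\<in>?I. if i < k \<and> k < j then r k else 0)"
      using ij by (simp add: T_less gate_res_eq r_def[symmetric] algebra_simps)
  qed
  also have "(\<Sum>i\<in>?I. \<Sum>j\<in>?I. f j * r j * (if i < j then s i else 0))
      = (\<Sum>j\<in>?I. \<Sum>i\<in>?I. f j * r j * (if i < j then s i else 0))"
    by (rule sum.swap)
  also note sum_between
  \<comment> \<open>The four kinds of terms in \<open>r k\<close> are exactly the expansion of this
    product: both gates of \<open>k\<close>, one gate and one side (twice), and both sides.\<close>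
  finally have "kf_PG n c = (\<Sum>i\<in>?I. 40 + 8 * (e i + f i))
      + (\<Sum>i\<in>?I. \<Sum>j\<in>?I. if i < j then 8 * s j + 8 * s i + s i * s j * real (j - i) else 0)
      + (\<Sum>k\<in>?I. r k * ((e k + (\<Sum>i\<in>?I. if i < k then s i else 0))
                           * (f k + (\<Sum>j\<in>?I. if k < j then s j else 0))))"
    by (simp add: sum_distrib_left[symmetric] sum.distrib algebra_simps)
  also have "\<dots> = kf_PG_offset n
       + (\<Sum>k\<in>{1..n}. 144 * (real k - 1) * (real n - real k) * pentagon_res 0 (c k))"
  proof -
    have "(\<Sum>k\<in>?I. r k * ((e k + (\<Sum>i\<in>?I. if i < k then s i else 0))
                           * (f k + (\<Sum>j\<in>?I. if k < j then s j else 0))))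
        = (\<Sum>k\<in>{1..n}. 144 * (real k - 1) * (real n - real k) * pentagon_res 0 (c k))"
    proof (intro sum.cong refl)
      fix k assume k: "k \<in> ?I"
      show "r k * ((e k + (\<Sum>i\<in>?I. if i < k then s i else 0))
                    * (f k + (\<Sum>j\<in>?I. if k < j then s j else 0)))
          = 144 * (real k - 1) * (real n - real k) * pentagon_res 0 (c k)"
        unfolding left[OF k] right[OF k] r_def by (simp add: algebra_simps)
    qed
    moreover have "kf_PG_offset n = (\<Sum>i\<in>?I. 40 + 8 * (e i + f i))
      + (\<Sum>i\<in>?I. \<Sum>j\<in>?I. if i < j then 8 * s j + 8 * s i + s i * s j * real (j - i) else 0)"
      unfolding kf_PG_offset_def Let_def s_def e_def f_def ..
    ultimately show ?thesis by simp
  qed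
  finally show ?thesis .
qed

section \<open>A central limit theorem for bounded triangular arrays\<close>

text \<open>The upper bound multiplies \<open>exp x >= 1 + x + x^2/2\<close> by
  \<open>1 - x + x^2/2\<close>, as the two quadratics have product \<open>1 + x^4/4\<close>. The
  lower bound is the tangent line.\<close>

lemma exp_minus_approx_quadratic:
  fixes x :: real
  assumes "0 \<le> x"
  shows "\<bar>exp (- x) - (1 - x)\<bar> \<le> x\<^sup>2 / 2"
proof -
  have "1 \<le> 1 + (x\<^sup>2 / 2)\<^sup>2" by simp
  also have "\<dots> = (1 - x + x\<^sup>2 / 2) * (1 + x + x\<^sup>2 / 2)"
    by (simp add: power2_eq_square field_simps)
  also have "\<dots> \<le> (1 - x + x\<^sup>2 / 2) * exp x"
  proof (rule mult_left_mono[OF exp_lower_Taylor_quadratic[OF assms]])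
    have "0 \<le> (1 - x)\<^sup>2 + 1" by simp
    then show "0 \<le> 1 - x + x\<^sup>2 / 2" by (simp add: power2_eq_square field_simps)
  qed
  finally have "exp (- x) \<le> 1 - x + x\<^sup>2 / 2"
    by (simp add: exp_minus field_simps)
  then show ?thesis
    using exp_ge_add_one_self[of "- x"] by simp
qed

context prob_space
begin

text \<open>Both terms are compared with \<open>1 - t^2 v / 2\<close>, where \<open>v\<close> is the
  variance. Boundedness replaces the third moment by \<open>b * v\<close> and \<open>v^2\<close> by
  \<open>b^2 * v\<close>; the remaining factor \<open>v\<close> makes the errors summable over a
  row.\<close>

lemma char_centered_bounded_approx:
  assumes Y: "random_variable borel Y" and bdd: "\<And>\<omega>. \<omega> \<in> space M \<Longrightarrow> \<bar>Y \<omega>\<bar> \<le> b"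
    and mean: "expectation Y = 0"
  shows "cmod (char (distr M borel Y) t - of_real (exp (- (t\<^sup>2 * expectation (\<lambda>\<omega>. (Y \<omega>)\<^sup>2) / 2))))
       \<le> (\<bar>t\<bar> ^ 3 * b / 6 + t ^ 4 * b\<^sup>2 / 8) * expectation (\<lambda>\<omega>. (Y \<omega>)\<^sup>2)"
proof -
  define v where "v = expectation (\<lambda>\<omega>. (Y \<omega>)\<^sup>2)"
  note [measurable] = Y
  have b: "0 \<le> b"
    using bdd not_empty by (meson abs_ge_zero ex_in_conv order_trans)
  have sq: "(Y \<omega>)\<^sup>2 \<le> b\<^sup>2" if "\<omega> \<in> space M" for \<omega>
    using power_mono[OF bdd[OF that], of 2] by simp
  have int1: "integrable M Y"
    using bdd by (intro integrable_const_bound[where B = b]) auto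
  have int2: "integrable M (\<lambda>\<omega>. (Y \<omega>)\<^sup>2)"
    using sq by (intro integrable_const_bound[where B = "b\<^sup>2"]) auto
  have v0: "0 \<le> v" unfolding v_def by simp
  have vb: "v \<le> b\<^sup>2"
    unfolding v_def using int2 sq by (intro integral_le_const) auto
  have "cmod (char (distr M borel Y) t - (1 - t\<^sup>2 * v / 2))
      \<le> t\<^sup>2 / 6 * expectation (\<lambda>\<omega>. min (6 * (Y \<omega>)\<^sup>2) (\<bar>t\<bar> * \<bar>Y \<omega>\<bar> ^ 3))"
    using int1 int2 mean by (intro char_approx3') (auto simp: v_def)
  also have "\<dots> \<le> t\<^sup>2 / 6 * expectation (\<lambda>\<omega>. \<bar>t\<bar> * b * (Y \<omega>)\<^sup>2)"
  proof (intro mult_left_mono integral_mono)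
    show "integrable M (\<lambda>\<omega>. min (6 * (Y \<omega>)\<^sup>2) (\<bar>t\<bar> * \<bar>Y \<omega>\<bar> ^ 3))"
      by (rule Bochner_Integration.integrable_bound[OF integrable_mult_right[OF int2, of 6]]) auto
    show "integrable M (\<lambda>\<omega>. \<bar>t\<bar> * b * (Y \<omega>)\<^sup>2)"
      using int2 by simp
    fix \<omega> assume "\<omega> \<in> space M"
    then have "\<bar>Y \<omega>\<bar> * (Y \<omega>)\<^sup>2 \<le> b * (Y \<omega>)\<^sup>2"
      using bdd by (intro mult_right_mono) auto
    then have "\<bar>t\<bar> * \<bar>Y \<omega>\<bar> ^ 3 \<le> \<bar>t\<bar> * (b * (Y \<omega>)\<^sup>2)"
      by (intro mult_left_mono) (auto simp: power3_eq_cube power2_eq_square abs_mult[symmetric] mult.assoc)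
    then show "min (6 * (Y \<omega>)\<^sup>2) (\<bar>t\<bar> * \<bar>Y \<omega>\<bar> ^ 3) \<le> \<bar>t\<bar> * b * (Y \<omega>)\<^sup>2"
      by (simp add: mult.assoc)
  qed simp
  also have "\<dots> = \<bar>t\<bar> ^ 3 * b / 6 * v"
    by (simp add: v_def power3_eq_cube power2_eq_square)
  finally have 1: "cmod (char (distr M borel Y) t - of_real (1 - t\<^sup>2 * v / 2)) \<le> \<bar>t\<bar> ^ 3 * b / 6 * v"
    by simp
  have "cmod (of_real (1 - t\<^sup>2 * v / 2) - of_real (exp (- (t\<^sup>2 * v / 2))))
      = \<bar>exp (- (t\<^sup>2 * v / 2)) - (1 - t\<^sup>2 * v / 2)\<bar>"
    unfolding of_real_diff[symmetric] norm_of_real by (rule abs_minus_commute)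
  also have "\<dots> \<le> (t\<^sup>2 * v / 2)\<^sup>2 / 2"
    using v0 by (intro exp_minus_approx_quadratic) simp
  also have "\<dots> = t ^ 4 * v / 8 * v"
    by (simp add: power2_eq_square power4_eq_xxxx)
  also have "\<dots> \<le> t ^ 4 * b\<^sup>2 / 8 * v"
    using v0 vb by (intro mult_right_mono divide_right_mono mult_left_mono) auto
  finally have 2: "cmod (of_real (1 - t\<^sup>2 * v / 2) - of_real (exp (- (t\<^sup>2 * v / 2))))
      \<le> t ^ 4 * b\<^sup>2 / 8 * v" .
  show ?thesis
    unfolding v_def[symmetric] distrib_right
    by (rule norm_diff_triangle_le[OF 1 2])
qed

text \<open>By independence the characteristic function of a row sum is a product, and
  \<open>exp (- t^2 / 2)\<close> splits along the variances. For factors in the unit disc the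
  products differ by at most the sum of the differences, which tends to 0 with \<open>b\<close>;
  Levy continuity concludes.\<close>

theorem central_limit_theorem_bounded_array:
  fixes Y :: "nat \<Rightarrow> 'i \<Rightarrow> 'a \<Rightarrow> real"
  assumes indep: "\<And>n. indep_vars (\<lambda>_. borel) (Y n) (J n)"
    and bdd: "\<And>n k \<omega>. k \<in> J n \<Longrightarrow> \<omega> \<in> space M \<Longrightarrow> \<bar>Y n k \<omega>\<bar> \<le> b n"
    and b: "b \<longlonglongrightarrow> 0"
    and mean: "\<And>n k. k \<in> J n \<Longrightarrow> expectation (Y n k) = 0"
    and var: "\<And>n. (\<Sum>k\<in>J n. expectation (\<lambda>\<omega>. (Y n k \<omega>)\<^sup>2)) = 1"
  shows "weak_conv_m (\<lambda>n. distr M borel (\<lambda>\<omega>. \<Sum>k\<in>J n. Y n k \<omega>)) std_normal_distribution"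
proof (rule levy_continuity)
  have rv [measurable]: "random_variable borel (Y n k)" if "k \<in> J n" for n k
    using indep[of n] that unfolding indep_vars_def2 by blast
  show "real_distribution (distr M borel (\<lambda>\<omega>. \<Sum>k\<in>J n. Y n k \<omega>))" for n
    by (intro real_distribution_distr borel_measurable_sum rv)
  show "real_distribution std_normal_distribution"
    by (rule real_dist_normal_dist)
  fix t
  let ?v = "\<lambda>n k. expectation (\<lambda>\<omega>. (Y n k \<omega>)\<^sup>2)"
  \<comment> \<open>A sum over an infinite set is 0 by convention, so total variance 1 forces
    finiteness.\<close>
  have fin: "finite (J n)" for n
    using var[of n] by (rule contrapos_pp) simp
  have bound: "cmod (char (distr M borel (\<lambda>\<omega>. \<Sum>k\<in>J n. Y n k \<omega>)) t - of_real (exp (- (t\<^sup>2) / 2)))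
      \<le> \<bar>t\<bar> ^ 3 * b n / 6 + t ^ 4 * (b n)\<^sup>2 / 8" for n
  proof -
    have "(\<Prod>k\<in>J n. exp (- (t\<^sup>2 * ?v n k / 2))) = exp (- (t\<^sup>2) / 2 * (\<Sum>k\<in>J n. ?v n k))"
      unfolding sum_distrib_left exp_sum[OF fin] by simp
    then have e: "complex_of_real (exp (- (t\<^sup>2) / 2)) = (\<Prod>k\<in>J n. of_real (exp (- (t\<^sup>2 * ?v n k / 2))))"
      unfolding var mult_1_right of_real_prod[symmetric] by simp
    have "cmod (char (distr M borel (\<lambda>\<omega>. \<Sum>k\<in>J n. Y n k \<omega>)) t - of_real (exp (- (t\<^sup>2) / 2)))
        \<le> (\<Sum>k\<in>J n. cmod (char (distr M borel (Y n k)) t - of_real (exp (- (t\<^sup>2 * ?v n k / 2)))))"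
      unfolding e char_distr_sum[OF indep]
    proof (rule norm_prod_diff)
      fix k assume k: "k \<in> J n"
      interpret D: real_distribution "distr M borel (Y n k)"
        by (intro real_distribution_distr rv k)
      show "cmod (char (distr M borel (Y n k)) t) \<le> 1"
        by (rule D.cmod_char_le_1)
      show "cmod (of_real (exp (- (t\<^sup>2 * ?v n k / 2)))) \<le> 1"
        unfolding norm_of_real by simp
    qed
    also have "\<dots> \<le> (\<Sum>k\<in>J n. (\<bar>t\<bar> ^ 3 * b n / 6 + t ^ 4 * (b n)\<^sup>2 / 8) * ?v n k)"
      by (intro sum_mono char_centered_bounded_approx rv bdd mean)
    finally show ?thesis
      by (simp add: sum_distrib_left[symmetric] var)
  qed
  have lim: "(\<lambda>n. \<bar>t\<bar> ^ 3 * b n / 6 + t ^ 4 * (b n)\<^sup>2 / 8) \<longlonglongrightarrow> 0"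
    using b by (auto intro!: tendsto_eq_intros)
  have "(\<lambda>n. char (distr M borel (\<lambda>\<omega>. \<Sum>k\<in>J n. Y n k \<omega>)) t
      - of_real (exp (- (t\<^sup>2) / 2))) \<longlonglongrightarrow> 0"
    by (rule Lim_null_comparison[OF always_eventually[OF allI[OF bound]] lim])
  then show "(\<lambda>n. char (distr M borel (\<lambda>\<omega>. \<Sum>k\<in>J n. Y n k \<omega>)) t) \<longlonglongrightarrow> char std_normal_distribution t"
    unfolding char_std_normal_distribution by (rule LIM_zero_cancel)
qed

text \<open>Independence and zero means remove the cross terms of the expanded square; boundedness
  makes all products integrable.\<close>

lemma expectation_square_sum_indep:
  fixes X :: "'i \<Rightarrow> 'a \<Rightarrow> real"
  assumes fin: "finite J" and indep: "indep_vars (\<lambda>_. borel) X J"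
    and bdd: "\<And>k \<omega>. k \<in> J \<Longrightarrow> \<omega> \<in> space M \<Longrightarrow> \<bar>X k \<omega>\<bar> \<le> B"
    and mean: "\<And>k. k \<in> J \<Longrightarrow> expectation (X k) = 0"
  shows "expectation (\<lambda>\<omega>. (\<Sum>k\<in>J. w k * X k \<omega>)\<^sup>2) = (\<Sum>k\<in>J. (w k)\<^sup>2 * expectation (\<lambda>\<omega>. (X k \<omega>)\<^sup>2))"
proof -
  have rv [measurable]: "random_variable borel (X k)" if "k \<in> J" for k
    using indep that unfolding indep_vars_def2 by blast
  have int1: "integrable M (X k)" if "k \<in> J" for k
    using bdd that by (intro integrable_const_bound[where B = B]) auto
  have int: "integrable M (\<lambda>\<omega>. X j \<omega> * X k \<omega>)" if jk: "j \<in> J" "k \<in> J" for j k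
  proof (intro integrable_const_bound[where B = "B * B"] AE_I2)
    fix \<omega> assume "\<omega> \<in> space M"
    then show "norm (X j \<omega> * X k \<omega>) \<le> B * B"
      using mult_mono[OF bdd[OF jk(1), of \<omega>] bdd[OF jk(2), of \<omega>]] abs_ge_zero[of "X j \<omega>"]
        bdd[OF jk(1), of \<omega>] by (simp add: abs_mult)
  qed (use jk in measurable)
  have cross: "expectation (\<lambda>\<omega>. X j \<omega> * X k \<omega>) = (if j = k then expectation (\<lambda>\<omega>. (X k \<omega>)\<^sup>2) else 0)"
    if jk: "j \<in> J" "k \<in> J" for j k
  proof (cases "j = k")
    case False
    have "indep_vars (\<lambda>_. borel) X {j, k}"
      using indep_vars_subset[OF indep, of "{j, k}"] jk by simp
    then show ?thesis
      using indep_vars_lebesgue_integral[of "{j, k}" X] int1 mean jk False by auto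
  qed (simp add: power2_eq_square)
  have "expectation (\<lambda>\<omega>. (\<Sum>k\<in>J. w k * X k \<omega>)\<^sup>2)
      = expectation (\<lambda>\<omega>. \<Sum>j\<in>J. \<Sum>k\<in>J. (w j * w k) * (X j \<omega> * X k \<omega>))"
    by (simp add: power2_eq_square sum_product mult_ac)
  also have "\<dots> = (\<Sum>j\<in>J. \<Sum>k\<in>J. (w j * w k) * expectation (\<lambda>\<omega>. X j \<omega> * X k \<omega>))"
    by (simp add: Bochner_Integration.integral_sum int)
  also have "\<dots> = (\<Sum>j\<in>J. \<Sum>k\<in>J. if j = k then (w k)\<^sup>2 * expectation (\<lambda>\<omega>. (X k \<omega>)\<^sup>2) else 0)"
    by (intro sum.cong refl, subst cross) (auto simp: power2_eq_square)
  also have "\<dots> = (\<Sum>k\<in>J. (w k)\<^sup>2 * expectation (\<lambda>\<omega>. (X k \<omega>)\<^sup>2))"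
    using fin by simp
  finally show ?thesis .
qed

end

section \<open>Uniform convergence of distribution functions\<close>

lemma (in real_distribution) cdf_attains:
  assumes cont: "\<And>x. isCont (cdf M) x" and y: "0 < y" "y < 1"
  obtains x where "cdf M x = y"
proof -
  obtain l where l: "cdf M l < y"
    using order_tendstoD(2)[OF cdf_lim_at_bot y(1)] eventually_happens'[OF trivial_limit_at_bot_linorder]
    by blast
  obtain u where u: "y < cdf M u"
    using order_tendstoD(1)[OF cdf_lim_at_top_prob y(2)] eventually_happens'[OF trivial_limit_at_top_linorder]
    by blast
  have "l \<le> u"
    using cdf_nondecreasing[of u l] l u by linarith
  then show ?thesis
    using IVT[of "cdf M" l y u] l u cont that by auto
qed

text \<open>Polya's theorem: by monotonicity it is enough to control the distribution functions at the
  quantiles \<open>i / N\<close> of the continuous limit.\<close>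
theorem weak_conv_m_imp_uniform_cdf:
  assumes "\<And>n. real_distribution (\<mu> n)" and "real_distribution \<nu>"
    and conv: "weak_conv_m \<mu> \<nu>" and cont: "\<And>x. isCont (cdf \<nu>) x"
  shows "(\<lambda>n. SUP a. \<bar>cdf (\<mu> n) a - cdf \<nu> a\<bar>) \<longlonglongrightarrow> 0"
proof (rule LIMSEQ_I)
  interpret \<mu>: real_distribution "\<mu> n" for n by fact
  interpret \<nu>: real_distribution \<nu> by fact
  fix \<epsilon> :: real assume "0 < \<epsilon>"
  then obtain N :: nat where N: "4 / \<epsilon> < real N"
    using reals_Archimedean2 by blast
  have N0: "0 < real N"
    using N \<open>0 < \<epsilon>\<close> by (meson divide_pos_pos less_trans zero_less_numeral)
  have "\<exists>x. cdf \<nu> x = real i / real N" if "i \<in> {1..<N}" for i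
  proof -
    have "0 < real i / real N" "real i / real N < 1"
      using that by auto
    then show ?thesis
      using \<nu>.cdf_attains[OF cont] by metis
  qed
  then obtain x where x: "\<And>i. i \<in> {1..<N} \<Longrightarrow> cdf \<nu> (x i) = real i / real N"
    by metis
  have "eventually (\<lambda>n. \<forall>i\<in>{1..<N}. dist (cdf (\<mu> n) (x i)) (cdf \<nu> (x i)) < 1 / N) sequentially"
    using conv cont N0 unfolding weak_conv_m_def weak_conv_def
    by (intro eventually_ball_finite ballI tendstoD) auto
  then obtain n0 where n0: "\<And>n i. n \<ge> n0 \<Longrightarrow> i \<in> {1..<N} \<Longrightarrow> \<bar>cdf (\<mu> n) (x i) - real i / N\<bar> < 1 / N"
    unfolding eventually_sequentially dist_real_def using x by force
  have close: "\<bar>cdf (\<mu> n) a - cdf \<nu> a\<bar> \<le> 3 / N" if n: "n \<ge> n0" for n a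
  proof -
    \<comment> \<open>The limit at \<open>a\<close> lies between \<open>i / N\<close> and
      \<open>(i + 1) / N\<close>. Moving to an adjacent quantile costs \<open>1 / N\<close>, and so
      does the convergence there, which gives the bounds \<open>i + 2\<close> and
      \<open>i - 2\<close>. Where no such quantile exists, the bounds 0 and 1 for a distribution
      function suffice.\<close>
    define i where "i = nat \<lfloor>N * cdf \<nu> a\<rfloor>"
    have i: "real i \<le> N * cdf \<nu> a" "N * cdf \<nu> a < real i + 1"
      using \<nu>.cdf_nonneg[of a] unfolding i_def by (auto simp: of_nat_nat)
    have "N * cdf (\<mu> n) a \<le> real i + 2"
    proof (cases "i + 1 < N")
      case True
      then have m: "i + 1 \<in> {1..<N}" by simp
      have "cdf \<nu> a < cdf \<nu> (x (i + 1))"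
        using i(2) N0 unfolding x[OF m] by (simp add: field_simps)
      then have "a \<le> x (i + 1)"
        using \<nu>.cdf_nondecreasing[of "x (i + 1)" a] by linarith
      then have "cdf (\<mu> n) a \<le> cdf (\<mu> n) (x (i + 1))"
        by (rule \<mu>.cdf_nondecreasing)
      also have "\<dots> \<le> real (i + 1) / N + 1 / N"
        using n0[OF n m] by linarith
      finally show ?thesis
        using N0 by (simp add: field_simps)
    next
      case False
      have "real N * cdf (\<mu> n) a \<le> real N * 1"
        by (intro mult_left_mono \<mu>.cdf_bounded_prob) simp
      then show ?thesis using False by linarith
    qed
    \<comment> \<open>Quantile \<open>i - 1\<close> instead of \<open>i\<close> gives a strict
      inequality of values, hence an ordering of the points, and its index stays below
      \<open>N\<close> even if \<open>i = N\<close>.\<close>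
    moreover have "real i - 2 \<le> N * cdf (\<mu> n) a"
    proof (cases "2 \<le> i")
      case True
      have "real i \<le> N"
        using i(1) mult_left_mono[OF \<nu>.cdf_bounded_prob[of a], of "real N"] by simp
      then have m: "i - 1 \<in> {1..<N}" using True by auto
      have "cdf \<nu> (x (i - 1)) < cdf \<nu> a"
        using i(1) N0 True unfolding x[OF m] by (simp add: field_simps of_nat_diff)
      then have "x (i - 1) \<le> a"
        using \<nu>.cdf_nondecreasing[of a "x (i - 1)"] by linarith
      have "real (i - 1) / N - 1 / N \<le> cdf (\<mu> n) (x (i - 1))"
        using n0[OF n m] by linarith
      also have "\<dots> \<le> cdf (\<mu> n) a"
        using \<open>x (i - 1) \<le> a\<close> by (rule \<mu>.cdf_nondecreasing)
      finally have "(real i - 2) / N \<le> cdf (\<mu> n) a"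
        using True by (simp add: diff_divide_distrib)
      then show ?thesis
        using N0 by (simp add: pos_divide_le_eq mult.commute)
    next
      case False
      have "0 \<le> N * cdf (\<mu> n) a"
        using \<mu>.cdf_nonneg by simp
      then show ?thesis using False by linarith
    qed
    ultimately have "\<bar>N * cdf (\<mu> n) a - N * cdf \<nu> a\<bar> \<le> 3"
      using i by linarith
    then have "N * \<bar>cdf (\<mu> n) a - cdf \<nu> a\<bar> \<le> 3"
      using N0 by (simp add: right_diff_distrib[symmetric] abs_mult)
    then show ?thesis
      using N0 by (simp add: field_simps)
  qed
  have "norm ((SUP a. \<bar>cdf (\<mu> n) a - cdf \<nu> a\<bar>) - 0) < \<epsilon>" if "n \<ge> n0" for n
  proof -
    have "(SUP a. \<bar>cdf (\<mu> n) a - cdf \<nu> a\<bar>) \<le> 3 / N"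
      using close[OF that] by (intro cSUP_least) auto
    moreover have "0 \<le> (SUP a. \<bar>cdf (\<mu> n) a - cdf \<nu> a\<bar>)"
      using close[OF that] by (intro cSUP_upper2[where x = 0] bdd_aboveI2[where M = "3 / N"]) auto
    moreover have "3 / N < \<epsilon>"
      using N N0 \<open>0 < \<epsilon>\<close> by (simp add: field_simps)
    ultimately show ?thesis by simp
  qed
  then show "\<exists>n0. \<forall>n\<ge>n0. norm ((SUP a. \<bar>cdf (\<mu> n) a - cdf \<nu> a\<bar>) - 0) < \<epsilon>"
    by blast
qed

lemma cdf_std_normal_distribution:
  "cdf std_normal_distribution a
   = set_lebesgue_integral lborel {..a} (\<lambda>t. 1 / sqrt (2 * pi) * exp (- (t\<^sup>2) / 2))"
proof -
  have "cdf std_normal_distribution a = (\<integral>x. indicator {..a} x \<partial>std_normal_distribution)"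
    by (simp add: cdf_def)
  also have "\<dots> = (\<integral>x. std_normal_density x * indicator {..a} x \<partial>lborel)"
    by (subst integral_real_density) auto
  finally show ?thesis
    unfolding set_lebesgue_integral_def std_normal_density_def
    by (simp add: mult.commute)
qed

text \<open>The measure has a Lebesgue density, so points carry no mass.\<close>

lemma isCont_cdf_std_normal_distribution: "isCont (cdf std_normal_distribution) x"
proof -
  interpret real_distribution std_normal_distribution
    by (rule real_dist_normal_dist)
  have "AE y in lborel. y \<noteq> x"
    by (rule AE_lborel_singleton)
  then have "AE y in std_normal_distribution. y \<noteq> x"
    by (subst AE_density) (auto elim: eventually_mono)
  then have "prob {x} = 0"
    by (subst prob_eq_0) auto
  then show ?thesis
    unfolding isCont_cdf .
qed

section \<open>Variance and asymptotic normality\<close>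

lemma pentagon_res_0_cases:
  "a \<in> {1, 2, 3, 4} \<Longrightarrow> pentagon_res 0 a = 6/5 - 2/5 * of_bool (a \<in> {1, 4})"
  by (auto simp: pentagon_res_def)

text \<open>Keeping \<open>x\<close> apart from \<open>n\<close> makes induction possible. With
  \<open>m = k - 1\<close> the three terms come from the power sums of \<open>m^2\<close>,
  \<open>m^3\<close> and \<open>m^4\<close>.\<close>

lemma sum_squared_weights:
  fixes x :: real
  shows "(\<Sum>k\<in>{1..n}. ((real k - 1) * (x - real k))\<^sup>2)
       = (x - 1)\<^sup>2 * ((real n - 1) * real n * (2 * real n - 1)) / 6
         - (x - 1) * ((real n - 1)\<^sup>2 * (real n)\<^sup>2) / 2
         + (real n - 1) * real n * (2 * real n - 1) * (3 * (real n)\<^sup>2 - 3 * real n - 1) / 30"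
proof (induction n)
  case (Suc n)
  have "(\<Sum>k\<in>{1..Suc n}. ((real k - 1) * (x - real k))\<^sup>2)
      = (\<Sum>k\<in>{1..n}. ((real k - 1) * (x - real k))\<^sup>2) + (real n * (x - real n - 1))\<^sup>2"
    by (simp add: algebra_simps)
  then show ?case
    unfolding Suc.IH by (simp add: field_simps power2_eq_square)
qed simp

lemma sum_squared_weights_diagonal:
  "(\<Sum>k\<in>{1..n}. ((real k - 1) * (real n - real k))\<^sup>2) = ((real n - 1) ^ 5 - (real n - 1)) / 30"
  unfolding sum_squared_weights by (simp add: field_simps eval_nat_numeral)

theorem theorem3p3:
  fixes M :: "'a measure" and U :: "nat \<Rightarrow> 'a \<Rightarrow> nat" and p1 :: real
  assumes "prob_space M"
    and "\<And>i. i \<ge> 1 \<Longrightarrow> U i \<in> measurable M (count_space UNIV)"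
    and "\<And>\<omega>. \<omega> \<in> space M \<Longrightarrow> U 1 \<omega> < 5"
    and "\<And>i \<omega>. i \<ge> 2 \<Longrightarrow> \<omega> \<in> space M \<Longrightarrow> U i \<omega> \<in> {1, 2, 3, 4}"
    and "\<And>i. i \<ge> 2 \<Longrightarrow> measure M {\<omega> \<in> space M. U i \<omega> \<in> {1, 4}} = p1"
    and "prob_space.indep_vars M (\<lambda>_. count_space UNIV)
           (\<lambda>i \<omega>. (U i \<omega> \<in> {1, 4}, U i \<omega> \<in> {2, 3})) {2..}"
    and "0 < p1" and "p1 < 1"
  shows "(\<forall>n \<ge> 1.
           (\<integral>\<omega>. (kf_PG n (\<lambda>i. U i \<omega>) - (\<integral>\<omega>'. kf_PG n (\<lambda>i. U i \<omega>') \<partial>M))^2 \<partial>M)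
           = (sigma3sq p1 * real n ^ 5 - 5 * r3 p1 * real n ^ 4
              + 10 * sigma3sq_tilde p1 * real n ^ 3
              + (65 * r3 p1 - 30 * sigma3sq p1 - 45 * sigma3sq_tilde p1) * real n ^ 2
              + (59 * sigma3sq p1 + 65 * sigma3sq_tilde p1 - 120 * r3 p1) * real n
              + (60 * r3 p1 - 30 * sigma3sq p1 - 30 * sigma3sq_tilde p1)) / 30)
         \<and> ((\<lambda>n. SUP a :: real. \<bar>measure M {\<omega> \<in> space M.
              (kf_PG n (\<lambda>i. U i \<omega>) - (\<integral>\<omega>'. kf_PG n (\<lambda>i. U i \<omega>') \<partial>M))
              / sqrt (\<integral>\<omega>'. (kf_PG n (\<lambda>i. U i \<omega>')
                   - (\<integral>\<omega>''. kf_PG n (\<lambda>i. U i \<omega>'') \<partial>M))^2 \<partial>M) \<le> a}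
            - set_lebesgue_integral lborel {..a} (\<lambda>t. 1 / sqrt (2 * pi) * exp (- (t\<^sup>2) / 2))\<bar>)
          \<longlonglongrightarrow> 0)"
proof -
  interpret prob_space M by fact
  let ?kf = "\<lambda>n \<omega>. kf_PG n (\<lambda>i. U i \<omega>)"
  \<comment> \<open>Centred so that the crossing resistance is its mean
    \<open>6/5 - 2/5 * p1\<close> plus \<open>2/5 * X k\<close>; hence the constant
    \<open>288/5 = 144 * 2/5\<close> in \<open>w\<close>.\<close>
  define X :: "nat \<Rightarrow> 'a \<Rightarrow> real" where "X k \<omega> = p1 - of_bool (U k \<omega> \<in> {1, 4})" for k \<omega>
  define w :: "nat \<Rightarrow> nat \<Rightarrow> real" where "w n k = 288/5 * ((real k - 1) * (real n - real k))" for n k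
  define K where "K n = kf_PG_offset n
      + (\<Sum>k\<in>{2..n}. 144 * (real k - 1) * (real n - real k) * (6/5 - 2/5 * p1))" for n
  define V where "V n = (288/5)\<^sup>2 * (p1 * (1 - p1)) * ((real n - 1) ^ 5 - (real n - 1)) / 30" for n

  have kf: "?kf n \<omega> = K n + (\<Sum>k\<in>{2..n}. w n k * X k \<omega>)" if \<omega>: "\<omega> \<in> space M" for n \<omega>
  proof -
    have "U i \<omega> < 5" if "i \<in> {1..n}" for i
      using assms(3)[OF \<omega>] assms(4)[of i, OF _ \<omega>] that by (cases "i = 1") auto
    then have "?kf n \<omega> = kf_PG_offset n
        + (\<Sum>k\<in>{1..n}. 144 * (real k - 1) * (real n - real k) * pentagon_res 0 (U k \<omega>))"
      by (rule kf_PG_eq)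
    \<comment> \<open>Pentagon 1 has weight 0, so the sum may start at 2, where the choices are
      restricted to the four vertices other than \<open>x_1\<close>.\<close>
    also have "(\<Sum>k\<in>{1..n}. 144 * (real k - 1) * (real n - real k) * pentagon_res 0 (U k \<omega>))
        = (\<Sum>k\<in>{2..n}. 144 * (real k - 1) * (real n - real k) * (6/5 - 2/5 * p1) + w n k * X k \<omega>)"
    proof (rule sum.mono_neutral_cong_right)
      show "\<forall>i\<in>{1..n} - {2..n}. 144 * (real i - 1) * (real n - real i) * pentagon_res 0 (U i \<omega>) = 0"
      proof
        fix i assume "i \<in> {1..n} - {2..n}"
        then have "i = 1" by auto
        then show "144 * (real i - 1) * (real n - real i) * pentagon_res 0 (U i \<omega>) = 0" by simp
      qed
      fix k assume "k \<in> {2..n}"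
      then have p: "pentagon_res 0 (U k \<omega>) = 6/5 - 2/5 * p1 + 2/5 * X k \<omega>"
        using assms(4)[of k, OF _ \<omega>] by (subst pentagon_res_0_cases) (simp_all add: X_def field_simps)
      show "144 * (real k - 1) * (real n - real k) * pentagon_res 0 (U k \<omega>)
          = 144 * (real k - 1) * (real n - real k) * (6/5 - 2/5 * p1) + w n k * X k \<omega>"
        unfolding p w_def by (simp add: field_simps)
    qed auto
    finally show ?thesis
      by (simp add: K_def sum.distrib)
  qed

  have X_indep: "indep_vars (\<lambda>_. borel) X {2..}"
    using indep_vars_compose2[OF assms(6), of "\<lambda>_ z. p1 - of_bool (fst z)" "\<lambda>_. borel"]
    unfolding X_def[abs_def] by simp
  have X_rv: "random_variable borel (X k)" if "k \<ge> 2" for k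
    using X_indep that unfolding indep_vars_def2 by auto
  have X_bdd: "\<bar>X k \<omega>\<bar> \<le> 1" for k \<omega>
    using assms(7,8) by (simp add: X_def)
  have I: "integrable M (\<lambda>\<omega>. of_bool (U k \<omega> \<in> {1, 4}) :: real)"
      "expectation (\<lambda>\<omega>. of_bool (U k \<omega> \<in> {1, 4})) = p1" if k: "k \<ge> 2" for k
  proof -
    have m: "U k \<in> measurable M (count_space UNIV)"
      using k by (intro assms(2)) simp
    define A where "A = {\<omega> \<in> space M. U k \<omega> \<in> {1, 4}}"
    have A: "A \<in> sets M"
      using measurable_sets[OF m, of "{1, 4}"] by (simp add: A_def vimage_def Int_def conj_commute)
    have cong: "of_bool (U k \<omega> \<in> {1, 4}) = indicat_real A \<omega>" if "\<omega> \<in> space M" for \<omega>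
      using that by (simp add: A_def indicator_def)
    show "integrable M (\<lambda>\<omega>. of_bool (U k \<omega> \<in> {1, 4}) :: real)"
    proof (rule Bochner_Integration.integrable_cong[THEN iffD2, OF refl cong])
      show "integrable M (indicat_real A)"
        using A by (simp add: less_top[symmetric])
    qed
    show "expectation (\<lambda>\<omega>. of_bool (U k \<omega> \<in> {1, 4})) = p1"
    proof (rule trans[OF Bochner_Integration.integral_cong[OF refl cong]])
      have "expectation (indicat_real A) = prob A"
        using A by simp
      then show "expectation (indicat_real A) = p1"
        using assms(5)[OF k] by (simp only: A_def)
    qed
  qed
  have X_int: "integrable M (X k)" and X_mean: "expectation (X k) = 0" if "k \<ge> 2" for k
    using I[OF that] by (simp_all add: X_def[abs_def] prob_space)
  have X_var: "expectation (\<lambda>\<omega>. (X k \<omega>)\<^sup>2) = p1 * (1 - p1)" if "k \<ge> 2" for k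
  proof -
    have sq: "(X k \<omega>)\<^sup>2 = p1\<^sup>2 + (1 - 2 * p1) * of_bool (U k \<omega> \<in> {1, 4})" for \<omega>
      by (simp add: X_def power2_eq_square algebra_simps)
    have "expectation (\<lambda>\<omega>. (X k \<omega>)\<^sup>2) = p1\<^sup>2 + (1 - 2 * p1) * p1"
      unfolding sq using I[OF that] by (simp add: prob_space)
    then show ?thesis
      by (simp add: power2_eq_square algebra_simps)
  qed
  have w_sum: "(\<Sum>k\<in>{2..n}. (w n k)\<^sup>2 * (p1 * (1 - p1))) = V n" for n
  proof -
    have "(\<Sum>k\<in>{2..n}. ((real k - 1) * (real n - real k))\<^sup>2)
        = (\<Sum>k\<in>{1..n}. ((real k - 1) * (real n - real k))\<^sup>2)"
    proof (rule sum.mono_neutral_left)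
      show "\<forall>i\<in>{1..n} - {2..n}. ((real i - 1) * (real n - real i))\<^sup>2 = 0"
      proof
        fix i assume "i \<in> {1..n} - {2..n}"
        then have "i = 1" by auto
        then show "((real i - 1) * (real n - real i))\<^sup>2 = 0" by simp
      qed
    qed auto
    then have sq: "(\<Sum>k\<in>{2..n}. ((real k - 1) * (real n - real k))\<^sup>2)
        = ((real n - 1) ^ 5 - (real n - 1)) / 30"
      unfolding sum_squared_weights_diagonal .
    show ?thesis
      unfolding w_def V_def power_mult_distrib[of "288/5"] sum_distrib_right[symmetric]
        sum_distrib_left[symmetric] sq by (simp only: mult_ac times_divide_eq_right)
  qed
  have kf_mean: "expectation (?kf n) = K n" for n
  proof -
    have "expectation (?kf n) = expectation (\<lambda>\<omega>. K n + (\<Sum>k\<in>{2..n}. w n k * X k \<omega>))"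
      by (intro Bochner_Integration.integral_cong refl kf)
    also have "\<dots> = K n + expectation (\<lambda>\<omega>. \<Sum>k\<in>{2..n}. w n k * X k \<omega>)"
      using X_int by (subst Bochner_Integration.integral_add)
        (auto intro!: Bochner_Integration.integrable_sum simp: prob_space)
    also have "expectation (\<lambda>\<omega>. \<Sum>k\<in>{2..n}. w n k * X k \<omega>) = 0"
      using X_int X_mean by (subst Bochner_Integration.integral_sum) auto
    finally show ?thesis by simp
  qed
  have kf_var: "expectation (\<lambda>\<omega>. (?kf n \<omega> - expectation (?kf n))\<^sup>2) = V n" for n
  proof -
    have "expectation (\<lambda>\<omega>. (?kf n \<omega> - expectation (?kf n))\<^sup>2)
        = expectation (\<lambda>\<omega>. (\<Sum>k\<in>{2..n}. w n k * X k \<omega>)\<^sup>2)"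
      by (intro Bochner_Integration.integral_cong refl) (simp add: kf kf_mean)
    also have "\<dots> = (\<Sum>k\<in>{2..n}. (w n k)\<^sup>2 * expectation (\<lambda>\<omega>. (X k \<omega>)\<^sup>2))"
      using X_bdd X_mean
      by (intro expectation_square_sum_indep[where B = 1] indep_vars_subset[OF X_indep]) auto
    finally show ?thesis
      by (simp add: X_var w_sum)
  qed
  have var_formula: "V n = (sigma3sq p1 * real n ^ 5 - 5 * r3 p1 * real n ^ 4
              + 10 * sigma3sq_tilde p1 * real n ^ 3
              + (65 * r3 p1 - 30 * sigma3sq p1 - 45 * sigma3sq_tilde p1) * real n ^ 2
              + (59 * sigma3sq p1 + 65 * sigma3sq_tilde p1 - 120 * r3 p1) * real n
              + (60 * r3 p1 - 30 * sigma3sq p1 - 30 * sigma3sq_tilde p1)) / 30" for n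
  proof -
    define c where "c = (288/5)\<^sup>2 * (p1 * (1 - p1))"
    \<comment> \<open>All three are covariances of two-point variables driven by the same choice,
      and 1584 - 1296 = 1164 - 876 = 288. With equal constants the stated polynomial collapses to
      \<open>c * ((n - 1)^5 - (n - 1))\<close>.\<close>
    have "sigma3sq p1 = c" "sigma3sq_tilde p1 = c" "r3 p1 = c"
      by (simp_all add: c_def sigma3sq_def sigma3sq_tilde_def r3_def power2_eq_square field_simps)
    moreover have "V n = c * ((real n - 1) ^ 5 - (real n - 1)) / 30"
      by (simp add: V_def c_def)
    ultimately show ?thesis
      by (simp add: field_simps eval_nat_numeral)
  qed

  \<comment> \<open>\<open>V\<close> vanishes at 0, 1 and 2, so normalising to variance 1 starts at
    index 3; \<open>LIMSEQ_offset\<close> removes the shift at the end.\<close>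
  define Y where "Y n k \<omega> = w (n + 3) k * X k \<omega> / sqrt (V (n + 3))" for n k \<omega>
  have V_pos: "0 < V (n + 3)" for n
  proof -
    have "real n + 2 < (real n + 2) ^ 5"
      using power_strict_increasing[of 1 5 "real n + 2"] by simp
    then show ?thesis
      using assms(7,8) unfolding V_def by (intro divide_pos_pos mult_pos_pos) (simp_all add: add.commute)
  qed
  have "weak_conv_m (\<lambda>n. distr M borel (\<lambda>\<omega>. \<Sum>k\<in>{2..n + 3}. Y n k \<omega>)) std_normal_distribution"
  proof (rule central_limit_theorem_bounded_array
      [where b = "\<lambda>n. 288/5 * (real (n + 3))\<^sup>2 / sqrt (V (n + 3))"])
    show "indep_vars (\<lambda>_. borel) (Y n) {2..n + 3}" for n
      unfolding Y_def[abs_def]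
      by (rule indep_vars_compose2[OF indep_vars_subset[OF X_indep]]) auto
    show "\<bar>Y n k \<omega>\<bar> \<le> 288/5 * (real (n + 3))\<^sup>2 / sqrt (V (n + 3))"
      if k: "k \<in> {2..n + 3}" and "\<omega> \<in> space M" for n k \<omega>
    proof -
      have "\<bar>(real k - 1) * (real (n + 3) - real k)\<bar> \<le> real (n + 3) * real (n + 3)"
        unfolding abs_mult using k by (intro mult_mono) auto
      then have "\<bar>w (n + 3) k\<bar> \<le> 288/5 * (real (n + 3))\<^sup>2"
        unfolding w_def abs_mult[of "288/5"] power2_eq_square by simp
      then have "\<bar>w (n + 3) k\<bar> * \<bar>X k \<omega>\<bar> \<le> 288/5 * (real (n + 3))\<^sup>2 * 1"
        by (intro mult_mono X_bdd) auto
      then have "\<bar>w (n + 3) k\<bar> * \<bar>X k \<omega>\<bar> / sqrt (V (n + 3))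
          \<le> 288/5 * (real (n + 3))\<^sup>2 * 1 / sqrt (V (n + 3))"
        using V_pos[of n] by (intro divide_right_mono) auto
      then show ?thesis
        using V_pos[of n] by (simp add: Y_def abs_mult)
    qed
    show "(\<lambda>n. 288/5 * (real (n + 3))\<^sup>2 / sqrt (V (n + 3))) \<longlonglongrightarrow> 0"
    proof -
      \<comment> \<open>Naming the positive constant \<open>q\<close> leaves a limit in
        \<open>n\<close> alone, of order \<open>n^2 / n^(5/2)\<close>.\<close>
      define q where "q = p1 * (1 - p1)"
      have "0 < q" using assms(7,8) by (simp add: q_def)
      then show ?thesis unfolding V_def q_def[symmetric] by real_asymp
    qed
    show "expectation (Y n k) = 0" if "k \<in> {2..n + 3}" for n k
      using that by (simp add: Y_def[abs_def] X_mean)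
    show "(\<Sum>k\<in>{2..n + 3}. expectation (\<lambda>\<omega>. (Y n k \<omega>)\<^sup>2)) = 1" for n
    proof -
      have "(\<Sum>k\<in>{2..n + 3}. expectation (\<lambda>\<omega>. (Y n k \<omega>)\<^sup>2))
          = (\<Sum>k\<in>{2..n + 3}. (w (n + 3) k)\<^sup>2 * (p1 * (1 - p1)) / V (n + 3))"
        using V_pos[of n]
        by (intro sum.cong refl) (simp add: Y_def power_mult_distrib power_divide X_var)
      also have "\<dots> = V (n + 3) / V (n + 3)"
        unfolding sum_divide_distrib[symmetric] w_sum ..
      finally show ?thesis
        using V_pos[of n] by simp
    qed
  qed
  moreover have S_rv: "random_variable borel (\<lambda>\<omega>. \<Sum>k\<in>{2..n + 3}. Y n k \<omega>)" for n
    unfolding Y_def[abs_def]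
    by (intro borel_measurable_sum borel_measurable_divide borel_measurable_times borel_measurable_const X_rv) auto
  ultimately have "(\<lambda>n. SUP a. \<bar>cdf (distr M borel (\<lambda>\<omega>. \<Sum>k\<in>{2..n + 3}. Y n k \<omega>)) a
      - cdf std_normal_distribution a\<bar>) \<longlonglongrightarrow> 0"
    by (intro weak_conv_m_imp_uniform_cdf real_dist_normal_dist real_distribution_distr
        isCont_cdf_std_normal_distribution)
  moreover have "cdf (distr M borel (\<lambda>\<omega>. \<Sum>k\<in>{2..n + 3}. Y n k \<omega>)) a
      = prob {\<omega> \<in> space M. (?kf (n + 3) \<omega> - expectation (?kf (n + 3)))
          / sqrt (expectation (\<lambda>\<omega>. (?kf (n + 3) \<omega> - expectation (?kf (n + 3)))\<^sup>2)) \<le> a}" for n a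
  proof -
    have "(?kf (n + 3) \<omega> - expectation (?kf (n + 3)))
          / sqrt (expectation (\<lambda>\<omega>. (?kf (n + 3) \<omega> - expectation (?kf (n + 3)))\<^sup>2))
        = (\<Sum>k\<in>{2..n + 3}. Y n k \<omega>)" if "\<omega> \<in> space M" for \<omega>
      unfolding kf_var unfolding kf_mean kf[OF that] Y_def sum_divide_distrib[symmetric] by simp
    then have "{\<omega> \<in> space M. (?kf (n + 3) \<omega> - expectation (?kf (n + 3)))
          / sqrt (expectation (\<lambda>\<omega>. (?kf (n + 3) \<omega> - expectation (?kf (n + 3)))\<^sup>2)) \<le> a}
        = (\<lambda>\<omega>. \<Sum>k\<in>{2..n + 3}. Y n k \<omega>) -` {..a} \<inter> space M"
      by auto
    then show ?thesis
      unfolding cdf_def by (simp add: measure_distr[OF S_rv])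
  qed
  ultimately have lim: "(\<lambda>n. SUP a. \<bar>prob {\<omega> \<in> space M. (?kf (n + 3) \<omega> - expectation (?kf (n + 3)))
          / sqrt (expectation (\<lambda>\<omega>. (?kf (n + 3) \<omega> - expectation (?kf (n + 3)))\<^sup>2)) \<le> a}
      - set_lebesgue_integral lborel {..a} (\<lambda>t. 1 / sqrt (2 * pi) * exp (- (t\<^sup>2) / 2))\<bar>) \<longlonglongrightarrow> 0"
    by (simp only: cdf_std_normal_distribution)
  show ?thesis
    by (intro conjI allI impI trans[OF kf_var var_formula] LIMSEQ_offset[OF lim])
qed

end
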